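(* Let $K$ be a field of characteristic $0$, let $\widehat W$ be the completion of the associative algebra $W$ generated by two generic traceless $2\times2$ matrices $x,y$ over $K$, and let $t=\mathrm{tr}(x^2)$, $u=\mathrm{tr}(y^2)$, $v=\mathrm{tr}(xy)$. If $Q=\mathrm{M}(\exp(\mathrm{ad}\,X))$ is the associated matrix of the inner automorphism $\exp(\mathrm{ad}\,X)$ for an element $X\in\widehat W$, then the associated matrix $\mathrm{M}(\mathrm{ad}\,X)$ of the derivation $\mathrm{ad}\,X$ is $$\mathrm{M}(\mathrm{ad}\,X)=\frac{A(X)}{B(X)}(Q-I_3)-\frac{1}{2A(X)}(Q^2-I_3),$$ where $$\cosh(\sqrt{g(X)})=\frac12\left(\mathrm{tr}(Q)-1\right),$$ $$A(X)=\frac{\sinh(\sqrt{g(X)})}{\sqrt{g(X)}},\qquad B(X)=\frac{\cosh(\sqrt{g(X)})-1}{g(X)}.$$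
   Context: The generic traceless matrices are $x=\begin{pmatrix} x_{11} & x_{12} \\ x_{21} & -x_{11} \end{pmatrix}$, $y=\begin{pmatrix} y_{11} & y_{12} \\ y_{21} & -y_{11} \end{pmatrix}$ with $x_{11},x_{12},x_{21},y_{11},y_{12},y_{21}$ algebraically independent commuting variables; $W$ is the unital $K$-subalgebra of $M_2(K[x_{ij},y_{ij}])$ generated by $x,y$, polynomials being identified with scalar matrices. $W$ is graded by total degree in $x,y$, and $\widehat W$ is its completion in the formal power series topology (elements are formal series $f_0+f_1+\cdots$ with $f_n$ homogeneous of degree $n$). The elements $t,u,v\in W$ are central and algebraically independent, and $\widehat W$ is a free $K[[t,u,v]]$-module with basis $1,x,y,[x,y]$, where $[z_1,z_2]=z_1z_2-z_2z_1$. For $X\in\widehat W$, $\mathrm{ad}\,X$ acts by $z\,\mathrm{ad}\,X=[z,X]$ and $\exp(\mathrm{ad}\,X)=\sum_{n\ge0}\mathrm{ad}^nX/n!$. Both restrict to $K[[t,u,v]]$-module endomorphisms of the free submodule with basis $\{x,y,[x,y]\}$. For an endomorphism $\delta$ of this submodule, the associated matrix $\mathrm{M}(\delta)=(\sigma_{ij})\in M_3(K[[t,u,v]])$ is its matrix in this basis, with columns the coordinates of the images: $\delta(x)=\sigma_{11}x+\sigma_{21}y+\sigma_{31}[x,y]$, $\delta(y)=\sigma_{12}x+\sigma_{22}y+\sigma_{32}[x,y]$, $\delta([x,y])=\sigma_{13}x+\sigma_{23}y+\sigma_{33}[x,y]$. Writing $X=d+ax+by+c[x,y]$ with $a,b,c,d\in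 K[[t,u,v]]$ (the central summand $d$ does not affect $\mathrm{ad}\,X$), one sets $g(X)=2\left(a^2t+2abv+b^2u+2c^2(v^2-tu)\right)\in K[[t,u,v]]$, a series with zero constant term. $I_3$ is the $3\times3$ identity matrix. The hyperbolic expressions are formal power series in $g(X)$: $\cosh\sqrt w=\sum_{n\ge0}\frac{w^n}{(2n)!}$, $\frac{\sinh\sqrt w}{\sqrt w}=\sum_{n\ge0}\frac{w^n}{(2n+1)!}$, $\frac{\cosh\sqrt w-1}{w}=\sum_{n\ge0}\frac{w^n}{(2n+2)!}$; thus $A(X)$ and $B(X)$ are invertible in $K[[t,u,v]]$. *)

theory Defs
  imports "HOL-Analysis.Analysis" "HOL-Library.Poly_Mapping"
begin

section \<open>Generic traceless matrices\<close>

datatype gvar = X11 | X12 | X21 | Y11 | Y12 | Y21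

text \<open>The polynomial ring in six commuting variables, with the convolution product of
  finitely supported functions on exponent vectors.\<close>

type_synonym 'k mpoly = "(gvar \<Rightarrow>\<^sub>0 nat) \<Rightarrow>\<^sub>0 'k"

definition Const :: "'k::field_char_0 \<Rightarrow> 'k mpoly"
  where "Const c = Poly_Mapping.single 0 c"

definition Var :: "gvar \<Rightarrow> 'k::field_char_0 mpoly"
  where "Var v = Poly_Mapping.single (Poly_Mapping.single v 1) 1"

definition x_gen :: "'k::field_char_0 mpoly^2^2"
  where "x_gen = vector [vector [Var X11, Var X12], vector [Var X21, - Var X11]]"

definition y_gen :: "'k::field_char_0 mpoly^2^2"
  where "y_gen = vector [vector [Var Y11, Var Y12], vector [Var Y21, - Var Y11]]"

definition t_gen :: "'k::field_char_0 mpoly"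
  where "t_gen = trace (x_gen ** x_gen)"

definition u_gen :: "'k::field_char_0 mpoly"
  where "u_gen = trace (y_gen ** y_gen)"

definition v_gen :: "'k::field_char_0 mpoly"
  where "v_gen = trace (x_gen ** y_gen)"

inductive_set subalg :: "('k::field_char_0 mpoly^2^2) set \<Rightarrow> ('k mpoly^2^2) set"
  for S :: "('k mpoly^2^2) set"
where
  gen: "M \<in> S \<Longrightarrow> M \<in> subalg S"
| const: "mat (Const c) \<in> subalg S"
| add: "M \<in> subalg S \<Longrightarrow> N \<in> subalg S \<Longrightarrow> M + N \<in> subalg S"
| mult: "M \<in> subalg S \<Longrightarrow> N \<in> subalg S \<Longrightarrow> M ** N \<in> subalg S"

definition W_alg :: "('k::field_char_0 mpoly^2^2) set"
  where "W_alg = subalg {x_gen, y_gen}"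

section \<open>Grading and completion\<close>

definition mdeg :: "(gvar \<Rightarrow>\<^sub>0 nat) \<Rightarrow> nat"
  where "mdeg m = (\<Sum>v\<in>Poly_Mapping.keys m. Poly_Mapping.lookup m v)"

definition hom_part :: "nat \<Rightarrow> 'k::field_char_0 mpoly \<Rightarrow> 'k mpoly"
  where "hom_part n p = Poly_Mapping.mapp (\<lambda>m c. c when mdeg m = n) p"

text \<open>A formal series \<open>f\<^sub>0 + f\<^sub>1 + \<dots>\<close> with \<open>f\<^sub>n\<close> homogeneous of degree \<open>n\<close> is the
  power series in one marking variable whose \<open>n\<close>-th coefficient is \<open>f\<^sub>n\<close>. The library metric
  on such series, and the product topology on matrices over them, give the formal
  power series topology.\<close>

type_synonym 'k mser = "'k mpoly fps"

definition konst :: "'k::field_char_0 \<Rightarrow> 'k mser"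
  where "konst c = fps_const (Const c)"

definition emb :: "'k::field_char_0 mpoly \<Rightarrow> 'k mser"
  where "emb p = Abs_fps (\<lambda>n. hom_part n p)"

text \<open>The entries of \<open>x_gen\<close>, \<open>y_gen\<close> are homogeneous of degree 1, so the total degree
  in \<open>x\<close>, \<open>y\<close> is the total degree of the entries in the six variables.\<close>

definition homogeneous_mat :: "nat \<Rightarrow> 'k::field_char_0 mpoly^2^2 \<Rightarrow> bool"
  where "homogeneous_mat n M \<longleftrightarrow> map_matrix (hom_part n) M = M"

definition completion :: "('k::field_char_0 mpoly^2^2) set \<Rightarrow> ('k mser^2^2) set"
  where "completion S =
    {F. \<forall>n. map_matrix (\<lambda>f. fps_nth f n) F \<in> S
          \<and> homogeneous_mat n (map_matrix (\<lambda>f. fps_nth f n) F)}"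

definition W_hat :: "('k::field_char_0 mser^2^2) set"
  where "W_hat = completion W_alg"

definition x_hat :: "'k::field_char_0 mser^2^2"
  where "x_hat = map_matrix emb x_gen"

definition y_hat :: "'k::field_char_0 mser^2^2"
  where "y_hat = map_matrix emb y_gen"

definition t_hat :: "'k::field_char_0 mser"
  where "t_hat = emb t_gen"

definition u_hat :: "'k::field_char_0 mser"
  where "u_hat = emb u_gen"

definition v_hat :: "'k::field_char_0 mser"
  where "v_hat = emb v_gen"

text \<open>\<open>K[[t,u,v]]\<close>. A scalar \<open>f\<close> is identified with the scalar matrix \<open>mat f\<close>; in particular
  the scalar multiple of a matrix \<open>M\<close> by \<open>f\<close> is \<open>mat f ** M\<close>.\<close>

definition Ktuv :: "'k::field_char_0 mser set"
  where "Ktuv = {f. mat f \<in> completion (subalg {mat t_gen, mat u_gen, mat v_gen})}"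

section \<open>Inner derivations and automorphisms, and their matrices\<close>

definition commutator :: "'r::comm_ring_1^2^2 \<Rightarrow> 'r^2^2 \<Rightarrow> 'r^2^2"
  where "commutator z1 z2 = z1 ** z2 - z2 ** z1"

definition ad :: "'k::field_char_0 mser^2^2 \<Rightarrow> 'k mser^2^2 \<Rightarrow> 'k mser^2^2"
  where "ad X z = commutator z X"

definition exp_ad :: "'k::field_char_0 mser^2^2 \<Rightarrow> 'k mser^2^2 \<Rightarrow> 'k mser^2^2"
  where "exp_ad X z = suminf (\<lambda>n. mat (konst (1 / fact n)) ** (ad X ^^ n) z)"

definition basis3 :: "'k::field_char_0 mser^2^2^3"
  where "basis3 = vector [x_hat, y_hat, commutator x_hat y_hat]"

definition coords :: "'k::field_char_0 mser^2^2 \<Rightarrow> 'k mser^3"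
  where "coords z =
    (THE s. (\<forall>i. s $ i \<in> Ktuv) \<and> z = (\<Sum>i\<in>UNIV. mat (s $ i) ** basis3 $ i))"

definition assoc_mat ::
    "('k::field_char_0 mser^2^2 \<Rightarrow> 'k mser^2^2) \<Rightarrow> 'k mser^3^3"
  where "assoc_mat \<delta> = (\<chi> i j. coords (\<delta> (basis3 $ j)) $ i)"

section \<open>The series \<open>g(X)\<close> and the hyperbolic expressions\<close>

text \<open>Well defined on \<open>W_hat\<close>, which is free over \<open>Ktuv\<close> on \<open>1, x, y, [x,y]\<close>.\<close>

definition g_ser :: "'k::field_char_0 mser^2^2 \<Rightarrow> 'k mser"
  where "g_ser X = (THE w. \<exists>a\<in>Ktuv. \<exists>b\<in>Ktuv. \<exists>c\<in>Ktuv. \<exists>d\<in>Ktuv.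
    X = mat d + mat a ** x_hat + mat b ** y_hat + mat c ** commutator x_hat y_hat \<and>
    w = 2 * (a\<^sup>2 * t_hat + 2 * a * b * v_hat + b\<^sup>2 * u_hat
             + 2 * c\<^sup>2 * (v_hat\<^sup>2 - t_hat * u_hat)))"

text \<open>Substitution of \<open>w\<close>, a series without constant term, into
  \<open>cosh(\<surd>w)\<close>, \<open>sinh(\<surd>w)/\<surd>w\<close> and \<open>(cosh(\<surd>w) - 1)/w\<close>.\<close>

definition cosh_sqrt :: "'k::field_char_0 mser \<Rightarrow> 'k mser"
  where "cosh_sqrt w = fps_compose (Abs_fps (\<lambda>n. Const (1 / fact (2 * n)))) w"

definition sinh_sqrt_div :: "'k::field_char_0 mser \<Rightarrow> 'k mser"
  where "sinh_sqrt_div w = fps_compose (Abs_fps (\<lambda>n. Const (1 / fact (2 * n + 1)))) w"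

definition cosh_sqrt_m1_div :: "'k::field_char_0 mser \<Rightarrow> 'k mser"
  where "cosh_sqrt_m1_div w = fps_compose (Abs_fps (\<lambda>n. Const (1 / fact (2 * n + 2)))) w"

definition A_ser :: "'k::field_char_0 mser^2^2 \<Rightarrow> 'k mser"
  where "A_ser X = sinh_sqrt_div (g_ser X)"

definition B_ser :: "'k::field_char_0 mser^2^2 \<Rightarrow> 'k mser"
  where "B_ser X = cosh_sqrt_m1_div (g_ser X)"

text \<open>The library inverse of power series needs coefficients in a type with inverses,
  hence this inverse of a unit in a commutative ring.\<close>

definition unit_inv :: "'r::comm_ring_1 \<Rightarrow> 'r"
  where "unit_inv f = (THE h. f * h = 1)"

end

theory Submission
  imports Defs
begin

text \<open>
  Write \<open>X = d + a x + b y + c [x,y]\<close> with coefficients in \<open>K[[t,u,v]]\<close>, let \<open>D\<close> be the matrix of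
  \<open>ad X\<close> and \<open>g = g(X)\<close>. The traceless part \<open>X\<^sub>0\<close> of \<open>X\<close> satisfies \<open>X\<^sub>0\<^sup>2 = g/4\<close>, so \<open>ad X\<close> has
  the eigenvalues \<open>0\<close> and \<open>\<plusminus>\<surd>g\<close>, that is, \<open>D\<^sup>3 = g D\<close> (\<open>ad_matrix_cube\<close>). Hence the exponential
  series splits into its odd and even parts (\<open>exp_ad_eq\<close>):
  \<open>Q = 1 + A D + B D\<^sup>2\<close>. The trace of this identity, with \<open>tr D = 0\<close> and \<open>tr D\<^sup>2 = 2 g\<close>, is the
  formula for \<open>C = cosh \<surd>g = 1 + g B\<close>. Moreover \<open>Q\<^sup>2 = 1 + 2 A C D + 2 A\<^sup>2 D\<^sup>2\<close>, so in
  \<open>(A/B) (Q - 1) - (Q\<^sup>2 - 1)/(2 A)\<close> the terms in \<open>D\<^sup>2\<close> cancel and \<open>D\<close> remains with the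
  coefficient \<open>A\<^sup>2/B - C\<close>. This is \<open>1\<close>, because \<open>sinh\<^sup>2 = cosh\<^sup>2 - 1\<close> divided by \<open>cosh - 1\<close> is
  \<open>cosh + 1\<close>; in power series, \<open>A\<^sup>2 = B (C + 1)\<close> (\<open>sinh_series_square\<close>,
  \<open>matrix_log_formula\<close>).

  For these matrices to exist, every element of the completed algebra must have unique coordinates
  in \<open>K[[t,u,v]]\<close> with respect to \<open>1, x, y, [x,y]\<close>. Existence (\<open>W_hat_span\<close>) holds because the
  \<open>K[t,u,v]\<close>-span of these four matrices is stable under multiplication by \<open>x\<close> and \<open>y\<close>, and
  because the coefficients can be chosen homogeneous in each degree. Uniqueness
  (\<open>hat_coords_unique\<close>) holds even over all power series in the six variables: the Gram matrix of
  the four elements under the trace form has a nonzero multiple of \<open>(t u - v\<^sup>2)\<^sup>2\<close> as its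
  determinant, and \<open>t u - v\<^sup>2\<close> is not zero.\<close>

section \<open>The coefficient ring is an integral domain\<close>

text \<open>Polynomials over an integral domain form an integral domain as soon as the exponent vectors carry
  an order compatible with addition, since leading terms then multiply. An arbitrary order of the
  six variables induces such an order lexicographically.\<close>

instantiation gvar :: linorder
begin

primrec gvar_rank :: "gvar \<Rightarrow> nat" where
  "gvar_rank X11 = 0" | "gvar_rank X12 = 1" | "gvar_rank X21 = 2"
| "gvar_rank Y11 = 3" | "gvar_rank Y12 = 4" | "gvar_rank Y21 = 5"

definition less_eq_gvar :: "gvar \<Rightarrow> gvar \<Rightarrow> bool"
  where "less_eq_gvar a b \<longleftrightarrow> gvar_rank a \<le> gvar_rank b"

definition less_gvar :: "gvar \<Rightarrow> gvar \<Rightarrow> bool"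
  where "less_gvar a b \<longleftrightarrow> gvar_rank a < gvar_rank b"

instance
proof
  fix a b :: gvar
  show "a \<le> b \<Longrightarrow> b \<le> a \<Longrightarrow> a = b"
    by (cases a; cases b; simp add: less_eq_gvar_def)
qed (auto simp: less_eq_gvar_def less_gvar_def)

end

lemma UNIV_gvar: "(UNIV :: gvar set) = {X11, X12, X21, Y11, Y12, Y21}"
  by (auto intro: gvar.exhaust)

lemma all_gvar:
  "(\<forall>w. P w) \<longleftrightarrow> P X11 \<and> P X12 \<and> P X21 \<and> P Y11 \<and> P Y12 \<and> P Y21"
  by (metis gvar.exhaust)


section \<open>Scalar matrices\<close>

lemma mat_scale_nth: "(mat s ** M) $ i $ j = (s :: 'r::comm_ring_1) * M $ i $ j"
  by (simp add: matrix_matrix_mult_def mat_def if_distrib if_distribR cong: if_cong)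

lemma mat_nth: "mat s $ i $ j = (if i = j then s else 0)"
  by (simp add: mat_def)

lemma mat_mult_mat: "mat p ** mat q = (mat (p * q) :: 'r::comm_ring_1^'n^'n)"
  by (simp add: vec_eq_iff mat_scale_nth mat_nth)

lemma mat_add_mat: "mat p + mat q = (mat (p + q) :: 'r::comm_ring_1^'n^'n)"
  by (simp add: vec_eq_iff mat_nth)

lemma mat_inj: "(mat p :: 'r::comm_ring_1^'n^'n) = mat q \<longleftrightarrow> p = q"
  by (auto simp: vec_eq_iff mat_nth)

lemma mat_commute: "M ** mat s = mat s ** (M :: 'r::comm_ring_1^'n^'n)"
  by (simp add: vec_eq_iff mat_scale_nth)
    (simp add: matrix_matrix_mult_def mat_def if_distrib mult.commute[of s] cong: if_cong)

lemma mat_scale_right: "M ** (mat s ** N) = mat s ** ((M :: 'r::comm_ring_1^'n^'n) ** N)"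
  unfolding matrix_mul_assoc mat_commute[of M] ..

lemma matrix_add_rdistrib: "(A + B) ** C = A ** C + B ** (C :: 'r::comm_ring_1^'n^'n)"
  by (simp add: vec_eq_iff matrix_matrix_mult_def ring_distribs sum.distrib)

lemma map_matrix_mat: "f 0 = 0 \<Longrightarrow> map_matrix f (mat p) = mat (f p)"
  by (simp add: vec_eq_iff mat_nth)


section \<open>Homogeneous components\<close>

lemma mdeg_eq: "mdeg m = (\<Sum>w\<in>UNIV. Poly_Mapping.lookup m w)"
proof -
  have "finite (UNIV :: gvar set)"
    by (simp add: UNIV_gvar)
  then show ?thesis
    unfolding mdeg_def by (intro sum.mono_neutral_left) (auto simp: in_keys_iff)
qed

lemma mdeg_add: "mdeg (m + m') = mdeg m + mdeg m'"
  by (simp add: mdeg_eq lookup_add sum.distrib)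

lemma lookup_hom_part:
  "Poly_Mapping.lookup (hom_part n p) m = (Poly_Mapping.lookup p m when mdeg m = n)"
  by (auto simp: hom_part_def lookup_mapp when_def in_keys_iff)

lemma hom_part_0 [simp]: "hom_part n 0 = 0"
  by (intro poly_mapping_eqI) (simp add: lookup_hom_part)

lemma hom_part_hom_part: "hom_part k (hom_part n p) = (if k = n then hom_part n p else 0)"
  by (intro poly_mapping_eqI) (auto simp: lookup_hom_part when_def)

lemma hom_part_single:
  "hom_part n (Poly_Mapping.single m c) = (if n = mdeg m then Poly_Mapping.single m c else 0)"
  by (intro poly_mapping_eqI) (auto simp: lookup_hom_part lookup_single when_def)

lemma emb_nth [simp]: "fps_nth (emb p) n = hom_part n p"
  by (simp add: emb_def)

lemma emb_0: "emb 0 = 0"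
  by (simp add: fps_eq_iff)

lemma emb_add: "emb (p + q) = emb p + emb q"
  by (simp add: fps_eq_iff poly_mapping_eq_iff fun_eq_iff lookup_add lookup_hom_part
      when_add_distrib)

lemma emb_uminus: "emb (- p) = - emb p"
  by (simp add: fps_eq_iff poly_mapping_eq_iff fun_eq_iff lookup_hom_part when_uminus_distrib)

lemma emb_diff: "emb (p - q) = emb p - emb q"
  using emb_add[of p "- q"] emb_uminus[of q] by simp

text \<open>A monomial is homogeneous, so its series has one term. Together with additivity this shows below
  that \<open>emb\<close> is a ring homomorphism, and every fact about degrees of products, here and
  later, is read off from that.\<close>

lemma emb_single: "emb (Poly_Mapping.single m c) = fps_const (Poly_Mapping.single m c) * fps_X ^ mdeg m"
  by (simp add: fps_eq_iff hom_part_single fps_mult_fps_X_power_commute[symmetric] fps_X_power_mult_nth)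

lemma mpoly_induct [case_names zero single add]:
  fixes p :: "'k::field_char_0 mpoly"
  assumes "P 0" "\<And>m c. P (Poly_Mapping.single m c)" "\<And>p q. P p \<Longrightarrow> P q \<Longrightarrow> P (p + q)"
  shows "P p"
proof -
  have "P (\<Sum>m\<in>A. Poly_Mapping.single m (Poly_Mapping.lookup p m))" if "finite A" for A
    using that by induction (auto intro: assms)
  moreover have "p = (\<Sum>m\<in>Poly_Mapping.keys p. Poly_Mapping.single m (Poly_Mapping.lookup p m))"
    by (intro poly_mapping_eqI)
      (auto simp: lookup_sum lookup_single when_def in_keys_iff)
  ultimately show ?thesis
    by (metis finite_keys)
qed

lemma emb_mult: "emb (p * q) = emb p * emb q"
proof (induction p rule: mpoly_induct)
  case (single m c)
  show ?case
  proof (induction q rule: mpoly_induct)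
    case (single m' c')
    show ?case
      by (simp add: mult_single emb_single mdeg_add power_add mult_ac flip: fps_const_mult)
  qed (simp_all add: emb_0 emb_add ring_distribs)
qed (simp_all add: emb_0 emb_add ring_distribs)

lemma emb_Const: "emb (Const c) = konst c"
  by (simp add: Const_def konst_def emb_single mdeg_eq)

lemma emb_two: "emb 2 = 2"
proof -
  have "emb 1 = 1"
    using emb_Const[of 1] by (simp add: Const_def konst_def)
  then show ?thesis
    using emb_add[of 1 1] by (metis one_add_one)
qed

lemma emb_Var: "emb (Var w) = fps_const (Var w) * fps_X"
proof -
  have "mdeg (Poly_Mapping.single w 1) = 1"
    by (cases w; simp add: mdeg_eq UNIV_gvar lookup_single)
  then show ?thesis
    by (simp add: Var_def emb_single)
qed

lemma homogeneous_iff_emb: "hom_part n p = p \<longleftrightarrow> emb p = fps_const p * fps_X ^ n"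
proof
  assume "hom_part n p = p"
  then have "hom_part k p = (if k = n then p else 0)" for k
    by (metis hom_part_hom_part)
  then show "emb p = fps_const p * fps_X ^ n"
    by (simp add: fps_eq_iff fps_mult_fps_X_power_commute[symmetric] fps_X_power_mult_nth)
next
  assume "emb p = fps_const p * fps_X ^ n"
  then have "fps_nth (emb p) n = fps_nth (fps_const p * fps_X ^ n) n" by simp
  then show "hom_part n p = p"
    by (simp add: fps_mult_fps_X_power_commute[symmetric] fps_X_power_mult_nth)
qed

lemma homogeneous_mult:
  "hom_part i p = p \<Longrightarrow> hom_part j q = q \<Longrightarrow> hom_part (i + j) (p * q) = p * q"
  unfolding homogeneous_iff_emb
  by (simp add: emb_mult power_add mult_ac flip: fps_const_mult)

lemma homogeneous_add:
  "hom_part i p = p \<Longrightarrow> hom_part i q = q \<Longrightarrow> hom_part i (p + q) = p + q"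
  using emb_add[of p q] by (simp add: fps_eq_iff)

lemma homogeneous_sum:
  "(\<And>i. i \<in> I \<Longrightarrow> hom_part n (f i) = f i) \<Longrightarrow> hom_part n (\<Sum>i\<in>I. f i) = (\<Sum>i\<in>I. f i)"
  by (induction I rule: infinite_finite_induct) (auto intro: homogeneous_add)

lemma homogeneous_Const: "hom_part 0 (Const c) = Const c"
  unfolding homogeneous_iff_emb by (simp add: emb_Const konst_def)


section \<open>Generic traceless matrices\<close>

lemmas mat2_simps = vec_eq_iff forall_2 matrix_matrix_mult_def sum_2 trace_def mat_def
  commutator_def

definition traceless :: "'r::comm_ring_1^2^2 \<Rightarrow> bool"
  where "traceless M \<longleftrightarrow> M $ 2 $ 2 = - M $ 1 $ 1"

text \<open>By Cayley and Hamilton \<open>x\<^sup>2\<close> and \<open>x y + y x\<close> are the scalars \<open>tr(x\<^sup>2)/2\<close> and \<open>tr(x y)\<close>, which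
  reduces \<open>x\<^sup>2 y - 2 x y x + y x\<^sup>2\<close>.\<close>

lemma double_commutator:
  assumes "traceless x" "traceless y"
  shows "commutator x (commutator x y)
    = mat (2 * trace (x ** x)) ** y - mat (2 * trace (x ** y)) ** x"
  using assms by (simp add: traceless_def mat2_simps algebra_simps)

text \<open>The multiplication table of \<open>1, x, y, [x,y]\<close> from the left by \<open>x\<close>; the table for \<open>y\<close> arises by
  exchanging the two. The last line has no factor \<open>1/2\<close>, since \<open>x\<close> anticommutes with
  \<open>[x,y]\<close>, so that their product is half of their commutator.\<close>

lemma left_mult_traceless:
  fixes h :: "'r::comm_ring_1"
  assumes "traceless x" "traceless y" and h: "2 * h = 1"
  shows "x ** x = mat (h * trace (x ** x))"
    and "x ** y = mat (h * trace (x ** y)) + mat h ** commutator x y"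
    and "x ** commutator x y = mat (trace (x ** x)) ** y - mat (trace (x ** y)) ** x"
proof -
  have h': "h * r + h * r = r" "h * r + (h * r + s) = r + s" "h * (2 * r) = r" for r s
    using h by (metis distrib_right mult_2 mult_1, metis add.assoc distrib_right mult_2 mult_1,
        metis mult.assoc mult.commute mult_1)
  show "x ** x = mat (h * trace (x ** x))"
    using assms(1,2) by (simp add: traceless_def mat2_simps algebra_simps h')
  show "x ** y = mat (h * trace (x ** y)) + mat h ** commutator x y"
    using assms(1,2) by (simp add: traceless_def mat2_simps algebra_simps h')
  show "x ** commutator x y = mat (trace (x ** x)) ** y - mat (trace (x ** y)) ** x"
    using assms by (simp add: traceless_def mat2_simps algebra_simps)
qed

lemma traceless_gen: "traceless x_gen" "traceless y_gen"
  by (simp_all add: traceless_def x_gen_def y_gen_def)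

lemma traceless_hat: "traceless x_hat" "traceless y_hat"
  by (simp_all add: traceless_def x_hat_def y_hat_def x_gen_def y_gen_def emb_uminus)

lemma x_hat_nth: "x_hat $ i $ j = fps_const (x_gen $ i $ j) * fps_X"
  and y_hat_nth: "y_hat $ i $ j = fps_const (y_gen $ i $ j) * fps_X"
  using exhaust_2[of i] exhaust_2[of j]
  by (auto simp: x_hat_def x_gen_def y_hat_def y_gen_def emb_Var emb_uminus simp flip: fps_const_neg)

lemma commutator_hat_nth:
  "commutator x_hat y_hat $ i $ j = fps_const (commutator x_gen y_gen $ i $ j) * fps_X ^ 2"
  by (simp add: commutator_def matrix_matrix_mult_def sum_2 x_hat_nth y_hat_nth
      power2_eq_square ring_distribs mult_ac flip: fps_const_mult fps_const_add fps_const_sub)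

lemma trace_hat:
  "t_hat = trace (x_hat ** x_hat)" "u_hat = trace (y_hat ** y_hat)" "v_hat = trace (x_hat ** y_hat)"
  by (simp_all add: t_hat_def u_hat_def v_hat_def t_gen_def u_gen_def v_gen_def mat2_simps
      x_hat_def y_hat_def emb_add emb_mult emb_two)

lemma tuv_hat_eq:
  "t_hat = fps_const t_gen * fps_X ^ 2" "u_hat = fps_const u_gen * fps_X ^ 2"
  "v_hat = fps_const v_gen * fps_X ^ 2"
  by (simp_all add: trace_hat t_gen_def u_gen_def v_gen_def trace_def matrix_matrix_mult_def sum_2
      x_hat_nth y_hat_nth power2_eq_square ring_distribs mult_ac 
      flip: fps_const_mult fps_const_add)


section \<open>The series ring in t, u, v\<close>

text \<open>The polynomial ring \<open>K[t,u,v]\<close>, whose completion is \<open>Ktuv\<close>.\<close>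

definition Ptuv :: "'k::field_char_0 mpoly set"
  where "Ptuv = {p. mat p \<in> subalg {mat t_gen, mat u_gen, mat v_gen}}"

lemma Ptuv_gen: "t_gen \<in> Ptuv" "u_gen \<in> Ptuv" "v_gen \<in> Ptuv"
  by (auto simp: Ptuv_def intro: subalg.gen)

lemma Ptuv_Const: "Const c \<in> Ptuv"
  by (simp add: Ptuv_def subalg.const)

lemma Ptuv_add: "p \<in> Ptuv \<Longrightarrow> q \<in> Ptuv \<Longrightarrow> p + q \<in> Ptuv"
  using subalg.add[of "mat p" _ "mat q"] by (simp add: Ptuv_def mat_add_mat)

lemma Ptuv_mult: "p \<in> Ptuv \<Longrightarrow> q \<in> Ptuv \<Longrightarrow> p * q \<in> Ptuv"
  using subalg.mult[of "mat p" _ "mat q"] by (simp add: Ptuv_def mat_mult_mat)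

lemma Ptuv_0: "0 \<in> Ptuv" and Ptuv_1: "1 \<in> Ptuv"
  using Ptuv_Const[of 0] Ptuv_Const[of 1] by (simp_all add: Const_def)

lemma Ptuv_uminus: "p \<in> Ptuv \<Longrightarrow> - p \<in> Ptuv"
  using Ptuv_mult[OF Ptuv_Const[of "- 1"], of p] by (simp add: Const_def single_uminus)

lemma Ptuv_diff: "p \<in> Ptuv \<Longrightarrow> q \<in> Ptuv \<Longrightarrow> p - q \<in> Ptuv"
  using Ptuv_add[OF _ Ptuv_uminus, of p q] by simp

lemma Ptuv_sum: "(\<And>i. i \<in> I \<Longrightarrow> f i \<in> Ptuv) \<Longrightarrow> (\<Sum>i\<in>I. f i) \<in> Ptuv"
  by (induction I rule: infinite_finite_induct) (auto intro: Ptuv_0 Ptuv_add)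

lemma tuv_homogeneous:
  "hom_part n t_gen = (if n = 2 then t_gen else 0)"
  "hom_part n u_gen = (if n = 2 then u_gen else 0)"
  "hom_part n v_gen = (if n = 2 then v_gen else 0)"
proof -
  have "hom_part 2 t_gen = t_gen" "hom_part 2 u_gen = u_gen" "hom_part 2 v_gen = v_gen"
    unfolding homogeneous_iff_emb using tuv_hat_eq by (simp_all add: t_hat_def u_hat_def v_hat_def)
  then show "hom_part n t_gen = (if n = 2 then t_gen else 0)"
    "hom_part n u_gen = (if n = 2 then u_gen else 0)"
    "hom_part n v_gen = (if n = 2 then v_gen else 0)"
    by (metis hom_part_hom_part)+
qed

text \<open>The generators \<open>t, u, v\<close> are homogeneous, so \<open>K[t,u,v]\<close> is a graded subring.\<close>

lemma Ptuv_hom_part: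
  assumes "p \<in> Ptuv"
  shows "hom_part n p \<in> Ptuv"
proof -
  have "\<exists>p. M = mat p \<and> (\<forall>n. hom_part n p \<in> Ptuv)"
    if "M \<in> subalg {mat t_gen, mat u_gen, mat v_gen}" for M :: "'a mpoly^2^2"
    using that
  proof induction
    case (gen M)
    have "hom_part n p \<in> Ptuv" if "p \<in> {t_gen, u_gen, v_gen}" for n and p :: "'a mpoly"
      using that by (auto simp: tuv_homogeneous Ptuv_gen Ptuv_0)
    with gen show ?case by blast
  next
    case (const c)
    have "hom_part n (Const c) \<in> Ptuv" for n
      using Ptuv_Const[of c] by (simp add: Const_def hom_part_single Ptuv_0)
    then show ?case by blast
  next
    case (add M N)
    then obtain p q where pq: "M = mat p" "N = mat q"
      "\<And>n. hom_part n p \<in> Ptuv" "\<And>n. hom_part n q \<in> Ptuv" by metis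
    have "hom_part n (p + q) \<in> Ptuv" for n
      using Ptuv_add[OF pq(3)[of n] pq(4)[of n]] emb_add[of p q] by (simp add: fps_eq_iff)
    then show ?case using pq by (auto simp: mat_add_mat)
  next
    case (mult M N)
    then obtain p q where pq: "M = mat p" "N = mat q"
      "\<And>n. hom_part n p \<in> Ptuv" "\<And>n. hom_part n q \<in> Ptuv" by metis
    have "hom_part n (p * q) = (\<Sum>i=0..n. hom_part i p * hom_part (n - i) q)" for n
      using emb_mult[of p q] by (simp add: fps_eq_iff fps_mult_nth)
    then have "hom_part n (p * q) \<in> Ptuv" for n
      by (simp only:) (intro Ptuv_sum Ptuv_mult pq)
    then show ?case using pq by (auto simp: mat_mult_mat)
  qed
  from this[of "mat p"] assms show ?thesis
    by (auto simp: Ptuv_def mat_inj)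
qed

lemma Ktuv_iff: "f \<in> Ktuv \<longleftrightarrow> (\<forall>n. fps_nth f n \<in> Ptuv \<and> hom_part n (fps_nth f n) = fps_nth f n)"
  by (simp add: Ktuv_def completion_def Ptuv_def homogeneous_mat_def map_matrix_mat mat_inj)

lemma Ktuv_emb: "p \<in> Ptuv \<Longrightarrow> emb p \<in> Ktuv"
  by (simp add: Ktuv_iff Ptuv_hom_part hom_part_hom_part)

lemma Ktuv_konst: "konst c \<in> Ktuv"
  using Ktuv_emb[OF Ptuv_Const] by (simp add: emb_Const)

lemma Ktuv_hat: "t_hat \<in> Ktuv" "u_hat \<in> Ktuv" "v_hat \<in> Ktuv"
  by (simp_all add: t_hat_def u_hat_def v_hat_def Ktuv_emb Ptuv_gen)

lemma Ktuv_add: "f \<in> Ktuv \<Longrightarrow> g \<in> Ktuv \<Longrightarrow> f + g \<in> Ktuv"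
  by (simp add: Ktuv_iff Ptuv_add homogeneous_add)

lemma Ktuv_mult:
  assumes "f \<in> Ktuv" "g \<in> Ktuv"
  shows "f * g \<in> Ktuv"
  unfolding Ktuv_iff fps_mult_nth
proof (intro allI conjI Ptuv_sum homogeneous_sum)
  fix n i :: nat
  assume i: "i \<in> {0..n}"
  show "fps_nth f i * fps_nth g (n - i) \<in> Ptuv"
    using assms by (simp add: Ktuv_iff Ptuv_mult)
  show "hom_part n (fps_nth f i * fps_nth g (n - i)) = fps_nth f i * fps_nth g (n - i)"
    using homogeneous_mult[of i "fps_nth f i" "n - i" "fps_nth g (n - i)"] assms i
    by (simp add: Ktuv_iff)
qed

lemma Ktuv_0: "0 \<in> Ktuv" and Ktuv_1: "1 \<in> Ktuv"
  using Ktuv_konst[of 0] Ktuv_konst[of 1] by (simp_all add: konst_def Const_def)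

lemma Ktuv_uminus: "f \<in> Ktuv \<Longrightarrow> - f \<in> Ktuv"
  using Ktuv_mult[OF Ktuv_konst[of "- 1"], of f] by (simp add: konst_def Const_def single_uminus flip: fps_const_neg)

lemma Ktuv_diff: "f \<in> Ktuv \<Longrightarrow> g \<in> Ktuv \<Longrightarrow> f - g \<in> Ktuv"
  using Ktuv_add[OF _ Ktuv_uminus, of f g] by simp

lemma Ktuv_two: "2 \<in> Ktuv"
  using Ktuv_add[OF Ktuv_1 Ktuv_1] by simp

lemma Ktuv_power: "f \<in> Ktuv \<Longrightarrow> f ^ n \<in> Ktuv"
  by (induction n) (auto intro: Ktuv_1 Ktuv_mult)

lemma Ktuv_sum: "(\<And>i. i \<in> I \<Longrightarrow> f i \<in> Ktuv) \<Longrightarrow> (\<Sum>i\<in>I. f i) \<in> Ktuv"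
  by (induction I rule: infinite_finite_induct) (auto intro: Ktuv_0 Ktuv_add)

lemmas Ktuv_closed = Ktuv_hat Ktuv_0 Ktuv_1 Ktuv_two Ktuv_add Ktuv_diff Ktuv_uminus Ktuv_mult
  Ktuv_power


section \<open>Coordinates with respect to 1, x, y, [x,y]\<close>

text \<open>The set of all \<open>M\<close> that map the \<open>K[t,u,v]\<close>-span of \<open>1, x, y, [x,y]\<close> into itself by left
  multiplication is an algebra, so it suffices to look at \<open>M = x\<close> and \<open>M = y\<close>. Multiplying only by
  generators avoids the full multiplication table of the span.\<close>

lemma mult_subalg_span:
  fixes M :: "'k::field_char_0 mpoly^2^2"
  assumes "M \<in> W_alg"
    and "\<exists>d\<in>Ptuv. \<exists>a\<in>Ptuv. \<exists>b\<in>Ptuv. \<exists>c\<in>Ptuv.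
      N = mat d + mat a ** x_gen + mat b ** y_gen + mat c ** commutator x_gen y_gen"
  shows "\<exists>d\<in>Ptuv. \<exists>a\<in>Ptuv. \<exists>b\<in>Ptuv. \<exists>c\<in>Ptuv.
      M ** N = mat d + mat a ** x_gen + mat b ** y_gen + mat c ** commutator x_gen y_gen"
  using assms unfolding W_alg_def
proof (induction arbitrary: N)
  case (gen M)
  let ?h = "Const (1 / 2) :: 'k mpoly"
  let ?z = "commutator x_gen y_gen :: 'k mpoly^2^2"
  have h: "2 * ?h = 1"
  proof -
    have "?h + ?h = 1"
      by (simp add: Const_def flip: single_add)
    then show ?thesis by (metis mult_2)
  qed
  have z: "commutator y_gen x_gen = - ?z"
    by (simp add: commutator_def)
  have yx: "trace (y_gen ** x_gen) = (v_gen :: 'k mpoly)"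
    unfolding v_gen_def by (rule trace_mul_sym)
  note X = left_mult_traceless[OF traceless_gen h, folded t_gen_def v_gen_def]
  note Y = left_mult_traceless[OF traceless_gen(2,1) h, folded u_gen_def, unfolded yx z]
  from gen obtain d a b c where abcd: "d \<in> Ptuv" "a \<in> Ptuv" "b \<in> Ptuv" "c \<in> Ptuv"
    and N: "N = mat d + mat a ** x_gen + mat b ** y_gen + mat c ** ?z" by blast
  have dist: "M ** N = mat d ** M + mat a ** (M ** x_gen) + mat b ** (M ** y_gen)
      + mat c ** (M ** ?z)" for M :: "'k mpoly^2^2"
    unfolding N
    by (simp add: matrix_add_ldistrib mat_scale_right mat_commute[of M])
  consider "M = x_gen" | "M = y_gen"
    using gen by blast
  then show ?case
  proof cases
    case 1
    have "M ** N = mat (?h * (a * t_gen + b * v_gen)) + mat (d - c * v_gen) ** x_gen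
       + mat (c * t_gen) ** y_gen + mat (?h * b) ** ?z"
      unfolding dist unfolding 1 X by (simp add: vec_eq_iff mat_scale_nth mat_nth algebra_simps)
    then show ?thesis
      using abcd by (blast intro: Ptuv_add Ptuv_diff Ptuv_mult Ptuv_gen Ptuv_Const)
  next
    case 2
    have Y3: "y_gen ** ?z = mat v_gen ** y_gen - mat u_gen ** x_gen"
    proof -
      have "y_gen ** (- ?z) = - (y_gen ** ?z)"
        by (simp add: vec_eq_iff matrix_matrix_mult_def sum_negf)
      then show ?thesis
        using Y(3) by (metis minus_diff_eq minus_minus)
    qed
    have "M ** N = mat (?h * (a * v_gen + b * u_gen)) + mat (- (c * u_gen)) ** x_gen
       + mat (d + c * v_gen) ** y_gen + mat (- (?h * a)) ** ?z"
      unfolding dist unfolding 2 Y(1,2) Y3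
      by (simp add: vec_eq_iff mat_scale_nth mat_nth algebra_simps)
    then show ?thesis
      using abcd by (blast intro: Ptuv_add Ptuv_uminus Ptuv_mult Ptuv_gen Ptuv_Const)
  qed
next
  case (const e)
  then obtain d a b c where abcd: "d \<in> Ptuv" "a \<in> Ptuv" "b \<in> Ptuv" "c \<in> Ptuv"
    and N: "N = mat d + mat a ** x_gen + mat b ** y_gen + mat c ** commutator x_gen y_gen" by blast
  have "mat (Const e) ** N = mat (Const e * d) + mat (Const e * a) ** x_gen
      + mat (Const e * b) ** y_gen + mat (Const e * c) ** commutator x_gen y_gen"
    unfolding N by (simp add: vec_eq_iff mat_scale_nth mat_nth algebra_simps)
  then show ?case
    using abcd by (blast intro: Ptuv_mult Ptuv_Const)
next
  case (add M1 M2)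
  obtain d a b c where abcd: "d \<in> Ptuv" "a \<in> Ptuv" "b \<in> Ptuv" "c \<in> Ptuv"
    and N: "M1 ** N = mat d + mat a ** x_gen + mat b ** y_gen + mat c ** commutator x_gen y_gen"
    using add.IH(1)[OF add.prems] by blast
  obtain d' a' b' c' where abcd': "d' \<in> Ptuv" "a' \<in> Ptuv" "b' \<in> Ptuv" "c' \<in> Ptuv"
    and N': "M2 ** N = mat d' + mat a' ** x_gen + mat b' ** y_gen
      + mat c' ** commutator x_gen y_gen"
    using add.IH(2)[OF add.prems] by blast
  have "(M1 + M2) ** N = mat (d + d') + mat (a + a') ** x_gen + mat (b + b') ** y_gen
      + mat (c + c') ** commutator x_gen y_gen"
    unfolding matrix_add_rdistrib N N'
    by (simp add: vec_eq_iff mat_scale_nth mat_nth algebra_simps)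
  then show ?case
    using abcd abcd' by (blast intro: Ptuv_add)
next
  case (mult M1 M2)
  show ?case
    unfolding matrix_mul_assoc[symmetric] by (intro mult.IH(1) mult.IH(2) mult.prems)
qed

lemma W_alg_span:
  assumes "M \<in> W_alg"
  shows "\<exists>d\<in>Ptuv. \<exists>a\<in>Ptuv. \<exists>b\<in>Ptuv. \<exists>c\<in>Ptuv.
      M = mat d + mat a ** x_gen + mat b ** y_gen + mat c ** commutator x_gen y_gen"
proof -
  have "(mat 1 :: 'a mpoly^2^2)
      = mat 1 + mat 0 ** x_gen + mat 0 ** y_gen + mat 0 ** commutator x_gen y_gen"
    by (simp add: vec_eq_iff mat_scale_nth mat_nth)
  then have "\<exists>d\<in>Ptuv. \<exists>a\<in>Ptuv. \<exists>b\<in>Ptuv. \<exists>c\<in>Ptuv. (mat 1 :: 'a mpoly^2^2)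
      = mat d + mat a ** x_gen + mat b ** y_gen + mat c ** commutator x_gen y_gen"
    using Ptuv_0 Ptuv_1 by blast
  from mult_subalg_span[OF assms this] show ?thesis
    by simp
qed

text \<open>The homogeneous components of \<open>X\<close> have coefficients in \<open>K[t,u,v]\<close>, and only the homogeneous
  parts of the right degree contribute to them. The basis elements have degrees \<open>0, 1, 1, 2\<close>,
  so the component of degree \<open>n\<close> determines the coefficients in the degrees \<open>n\<close>,
  \<open>n - 1\<close>, \<open>n - 1\<close> and \<open>n - 2\<close>; collecting them over all \<open>n\<close> gives the four series.\<close>

lemma W_hat_span:
  fixes X :: "'k::field_char_0 mser^2^2"
  assumes "X \<in> W_hat"
  shows "\<exists>d\<in>Ktuv. \<exists>a\<in>Ktuv. \<exists>b\<in>Ktuv. \<exists>c\<in>Ktuv.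
      X = mat d + mat a ** x_hat + mat b ** y_hat + mat c ** commutator x_hat y_hat"
proof -
  let ?z = "commutator x_gen y_gen :: 'k mpoly^2^2"
  define F where "F n = map_matrix (\<lambda>f. fps_nth f n) X" for n
  have F: "F n \<in> W_alg" "map_matrix (hom_part n) (F n) = F n" for n
    using assms by (auto simp: F_def W_hat_def completion_def homogeneous_mat_def)
  have "\<forall>n. \<exists>d a b c. d \<in> Ptuv \<and> a \<in> Ptuv \<and> b \<in> Ptuv \<and> c \<in> Ptuv \<and>
      F n = mat d + mat a ** x_gen + mat b ** y_gen + mat c ** ?z"
    using W_alg_span[OF F(1)] by blast
  then obtain d a b c where abcd: "\<And>n. d n \<in> Ptuv" "\<And>n. a n \<in> Ptuv" "\<And>n. b n \<in> Ptuv"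
      "\<And>n. c n \<in> Ptuv"
    and F_eq: "\<And>n. F n = mat (d n) + mat (a n) ** x_gen + mat (b n) ** y_gen + mat (c n) ** ?z"
    by metis
  define D A B C where "D = Abs_fps (\<lambda>n. hom_part n (d n))"
    and "A = Abs_fps (\<lambda>n. hom_part n (a (n + 1)))"
    and "B = Abs_fps (\<lambda>n. hom_part n (b (n + 1)))"
    and "C = Abs_fps (\<lambda>n. hom_part n (c (n + 2)))"
  have "D \<in> Ktuv" "A \<in> Ktuv" "B \<in> Ktuv" "C \<in> Ktuv"
    using abcd by (simp_all add: Ktuv_iff D_def A_def B_def C_def Ptuv_hom_part hom_part_hom_part)
  moreover have "X = mat D + mat A ** x_hat + mat B ** y_hat + mat C ** commutator x_hat y_hat"
  proof -
    have "fps_nth (X $ i $ j) n = fps_nth ((mat D + mat A ** x_hat + mat B ** y_hat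
        + mat C ** commutator x_hat y_hat) $ i $ j) n" for i j n
    proof -
      have "fps_nth (X $ i $ j) n = F n $ i $ j"
        by (simp add: F_def)
      also have "\<dots> = hom_part n (F n $ i $ j)"
        using F(2)[of n] by (metis nth_map_matrix)
      also have "\<dots> = fps_nth (emb (F n $ i $ j)) n"
        by simp
      also have "emb (F n $ i $ j) = emb (mat (d n) $ i $ j)
          + emb (a n) * x_hat $ i $ j + emb (b n) * y_hat $ i $ j
          + emb (c n) * emb (?z $ i $ j)"
        by (simp add: F_eq emb_add emb_mult mat_scale_nth x_hat_def y_hat_def)
      also have "emb (?z $ i $ j) = commutator x_hat y_hat $ i $ j"
        by (simp add: commutator_def matrix_matrix_mult_def sum_2 emb_diff emb_add emb_mult
            x_hat_def y_hat_def)
      also have "fps_nth (emb (mat (d n) $ i $ j)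
          + emb (a n) * x_hat $ i $ j + emb (b n) * y_hat $ i $ j
          + emb (c n) * commutator x_hat y_hat $ i $ j) n
        = fps_nth (mat D $ i $ j + A * x_hat $ i $ j + B * y_hat $ i $ j
          + C * commutator x_hat y_hat $ i $ j) n"
      proof -
        \<comment> \<open>The degrees \<open>n - 1\<close> and \<open>n - 2\<close> truncate for \<open>n = 0\<close> and for \<open>n \<le> 1\<close>, but there the
          factors \<open>fps_X\<close> and \<open>fps_X\<^sup>2\<close> kill the terms concerned.\<close>
        have shift: "n \<noteq> 0 \<Longrightarrow> Suc (n - Suc 0) = n" "n \<noteq> 0 \<Longrightarrow> n \<noteq> 1 \<Longrightarrow> Suc (Suc (n - 2)) = n"
          "n < 2 \<longleftrightarrow> n = 0 \<or> n = 1"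
          by auto
        show ?thesis
          unfolding x_hat_nth y_hat_nth commutator_hat_nth mult.assoc[symmetric]
          by (cases "n = 0"; cases "n = 1")
            (simp_all add: mat_nth emb_0 fps_X_power_mult_right_nth D_def A_def B_def C_def shift
              del: mult_cancel_right)
      qed
      finally show ?thesis
        by (simp add: mat_scale_nth)
    qed
    then show ?thesis
      by (simp add: vec_eq_iff fps_eq_iff)
  qed
  ultimately show ?thesis
    by blast
qed

text \<open>Pair a vanishing combination with \<open>1, x, y, [x,y]\<close> under the trace form. The Gram matrix is block
  diagonal: \<open>1\<close> and \<open>[x,y]\<close> are orthogonal to everything else, with \<open>tr [x,y]\<^sup>2 = 2 (v\<^sup>2 - t u)\<close>,
  and the block of \<open>x, y\<close> has determinant \<open>t u - v\<^sup>2\<close>.\<close>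

lemma basis_independent:
  fixes x y :: "'r::idom^2^2"
  assumes xy: "traceless x" "traceless y"
    and two: "(2 :: 'r) \<noteq> 0"
    and disc: "trace (x ** x) * trace (y ** y) \<noteq> (trace (x ** y))\<^sup>2"
    and zero: "mat d + mat a ** x + mat b ** y + mat c ** commutator x y = 0"
  shows "d = 0" "a = 0" "b = 0" "c = 0"
proof -
  let ?z = "commutator x y"
  let ?t = "trace (x ** x)" and ?u = "trace (y ** y)" and ?v = "trace (x ** y)"
  have tr: "trace ((mat d + mat a ** x + mat b ** y + mat c ** ?z) ** M)
      = d * trace M + a * trace (x ** M) + b * trace (y ** M) + c * trace (?z ** M)" for M
    by (simp add: matrix_add_rdistrib trace_add matrix_mul_assoc[symmetric])
       (simp add: trace_def mat_scale_nth sum_distrib_left)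
  have t0: "trace x = 0" "trace y = 0" "trace ?z = 0" "trace (?z ** x) = 0" "trace (?z ** y) = 0"
    "trace (mat 1 :: 'r^2^2) = 2" "trace (0 :: 'r^2^2) = 0" "trace (x ** ?z) = 0" "trace (y ** ?z) = 0"
    using xy by (simp_all add: traceless_def mat2_simps algebra_simps)
  have zz: "trace (?z ** ?z) = 2 * (?v\<^sup>2 - ?t * ?u)"
    using xy by (simp add: traceless_def mat2_simps algebra_simps power2_eq_square)
  have yx: "trace (y ** x) = ?v"
    by (rule trace_mul_sym)
  have z0: "trace ((0 :: 'r^2^2) ** M) = 0" for M
    by (simp add: trace_def matrix_matrix_mult_def)
  show "d = 0"
    using tr[of "mat 1"] two by (simp add: zero z0 t0)
  have 1: "a * ?t + b * ?v = 0"
    using tr[of x] by (simp add: zero z0 t0 yx)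
  have 2: "a * ?v + b * ?u = 0"
    using tr[of y] by (simp add: zero z0 t0)
  have "a * (?t * ?u - ?v\<^sup>2) = ?u * (a * ?t + b * ?v) - ?v * (a * ?v + b * ?u)"
    "b * (?t * ?u - ?v\<^sup>2) = ?t * (a * ?v + b * ?u) - ?v * (a * ?t + b * ?v)"
    by (simp_all add: algebra_simps power2_eq_square)
  then have "a * (?t * ?u - ?v\<^sup>2) = 0" "b * (?t * ?u - ?v\<^sup>2) = 0"
    by (simp_all only: 1 2 mult_zero_right diff_self)
  then show "a = 0" "b = 0"
    using disc by simp_all
  have "c * (2 * (?v\<^sup>2 - ?t * ?u)) = 0"
    using tr[of ?z] by (simp add: zero z0 t0 zz)
  then show "c = 0"
    using two disc by simp
qed

text \<open>The monomial \<open>x\<^sub>1\<^sub>1\<^sup>2 y\<^sub>1\<^sub>2 y\<^sub>2\<^sub>1\<close> has coefficient \<open>4\<close> in \<open>t u\<close> and does not occur in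
  \<open>v\<^sup>2\<close>.\<close>

lemma disc_gen: "t_gen * u_gen \<noteq> (v_gen :: 'k::field_char_0 mpoly)\<^sup>2"
proof
  let ?e = "\<lambda>w. Poly_Mapping.single w (1 :: nat)"
  let ?s = "Poly_Mapping.single :: (gvar \<Rightarrow>\<^sub>0 nat) \<Rightarrow> 'k \<Rightarrow> 'k mpoly"
  \<comment> \<open>The exponent vector of \<open>x\<^sub>1\<^sub>1\<^sup>2 y\<^sub>1\<^sub>2 y\<^sub>2\<^sub>1\<close>; the comparison of monomials is left to the
    simplifier, variable by variable.\<close>
  let ?m = "?e X11 + ?e X11 + ?e Y12 + ?e Y21"
  have two: "2 * ?s m 1 = ?s m 2" for m
    by (metis mult_2 one_add_one single_add)
  have t: "t_gen = ?s (?e X11 + ?e X11) 2 + ?s (?e X12 + ?e X21) 2"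
    by (simp add: t_gen_def x_gen_def trace_def sum_2 matrix_matrix_mult_def Var_def mult_single
        add.commute[of "Poly_Mapping.single X21 (Suc 0)"] two)
  have u: "u_gen = ?s (?e Y11 + ?e Y11) 2 + ?s (?e Y12 + ?e Y21) 2"
    by (simp add: u_gen_def y_gen_def trace_def sum_2 matrix_matrix_mult_def Var_def mult_single
        add.commute[of "Poly_Mapping.single Y21 (Suc 0)"] two)
  have v: "v_gen = ?s (?e X11 + ?e Y11) 2 + ?s (?e X12 + ?e Y21) 1 + ?s (?e X21 + ?e Y12) 1"
    by (simp add: v_gen_def x_gen_def y_gen_def trace_def sum_2 matrix_matrix_mult_def Var_def
        mult_single two[symmetric])
  assume "t_gen * u_gen = (v_gen :: 'k mpoly)\<^sup>2"
  then have "Poly_Mapping.lookup (t_gen * u_gen) ?m = Poly_Mapping.lookup (v_gen * v_gen :: 'k mpoly) ?m"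
    by (simp add: power2_eq_square)
  then show False
    unfolding t u v
    by (simp add: ring_distribs mult_single lookup_add lookup_single when_def)
      (simp add: poly_mapping_eq_iff fun_eq_iff lookup_add lookup_single all_gvar when_def)
qed

lemma disc_hat: "t_hat * u_hat \<noteq> (v_hat :: 'k::field_char_0 mser)\<^sup>2"
proof
  assume "t_hat * u_hat = (v_hat :: 'k mser)\<^sup>2"
  then have "fps_const (t_gen * u_gen) * fps_X ^ 4 = fps_const ((v_gen :: 'k mpoly)\<^sup>2) * fps_X ^ 4"
    by (simp add: tuv_hat_eq power2_eq_square mult_ac numeral_eq_Suc flip: fps_const_mult)
  then show False
    using disc_gen[where ?'k = 'k] by simp
qed

definition lin_comb :: "'k::field_char_0 mser^3 \<Rightarrow> 'k mser^2^2"
  where "lin_comb s = (\<Sum>i\<in>UNIV. mat (s $ i) ** basis3 $ i)"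

lemma lin_comb_eq:
  "lin_comb s = mat (s $ 1) ** x_hat + mat (s $ 2) ** y_hat + mat (s $ 3) ** commutator x_hat y_hat"
  by (simp add: lin_comb_def sum_3 basis3_def)

lemma hat_coords_unique:
  fixes a b c d :: "'k::field_char_0 mser"
  assumes "mat d + mat a ** x_hat + mat b ** y_hat + mat c ** commutator x_hat y_hat
    = mat d' + mat a' ** x_hat + mat b' ** y_hat + mat c' ** commutator x_hat y_hat"
  shows "d = d'" "a = a'" "b = b'" "c = c'"
proof -
  have 0: "mat (d - d') + mat (a - a') ** x_hat + mat (b - b') ** y_hat
      + mat (c - c') ** commutator x_hat y_hat = 0"
  proof -
    have "mat (d - d') + mat (a - a') ** x_hat + mat (b - b') ** y_hat
      + mat (c - c') ** commutator x_hat y_hat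
      = (mat d + mat a ** x_hat + mat b ** y_hat + mat c ** commutator x_hat y_hat)
      - (mat d' + mat a' ** x_hat + mat b' ** y_hat + mat c' ** commutator x_hat y_hat)"
      by (simp add: vec_eq_iff mat_scale_nth mat_nth algebra_simps)
    then show ?thesis
      by (simp add: assms)
  qed
  have 1: "trace (x_hat ** x_hat) * trace (y_hat ** y_hat) \<noteq> (trace (x_hat ** y_hat) :: 'k mser)\<^sup>2"
    using disc_hat by (simp flip: trace_hat)
  show "d = d'" "a = a'" "b = b'" "c = c'"
    using basis_independent[OF traceless_hat _ 1 0] by simp_all
qed

lemma coords_lin_comb:
  assumes "\<And>i. s $ i \<in> Ktuv"
  shows "coords (lin_comb s) = s"
  unfolding coords_def lin_comb_def[symmetric]
proof (rule the_equality)
  show "(\<forall>i. s $ i \<in> Ktuv) \<and> lin_comb s = lin_comb s"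
    using assms by simp
next
  fix r
  assume "(\<forall>i. r $ i \<in> Ktuv) \<and> lin_comb s = lin_comb r"
  then have "mat 0 + mat (s $ 1) ** x_hat + mat (s $ 2) ** y_hat
      + mat (s $ 3) ** commutator x_hat y_hat
    = mat 0 + mat (r $ 1) ** x_hat + mat (r $ 2) ** y_hat + mat (r $ 3) ** commutator x_hat y_hat"
    by (simp add: lin_comb_eq)
  from hat_coords_unique[OF this] show "r = s"
    by (simp add: vec_eq_iff forall_3)
qed

lemma assoc_mat_eqI:
  assumes "\<And>i j. M $ i $ j \<in> Ktuv" and "\<And>j. \<delta> (basis3 $ j) = lin_comb (column j M)"
  shows "assoc_mat \<delta> = M"
  unfolding assoc_mat_def assms(2)
  using assms(1) by (simp add: vec_eq_iff coords_lin_comb column_def)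

text \<open>Uniqueness of the coordinates makes the description in \<open>g_ser\<close> definite.\<close>

lemma g_ser_eq:
  assumes "a \<in> Ktuv" "b \<in> Ktuv" "c \<in> Ktuv" "d \<in> Ktuv"
    and X: "X = mat d + mat a ** x_hat + mat b ** y_hat + mat c ** commutator x_hat y_hat"
  shows "g_ser X = 2 * (a\<^sup>2 * t_hat + 2 * a * b * v_hat + b\<^sup>2 * u_hat
             + 2 * c\<^sup>2 * (v_hat\<^sup>2 - t_hat * u_hat))" (is "_ = ?g a b c")
  unfolding g_ser_def
proof (rule the_equality)
  show "\<exists>a'\<in>Ktuv. \<exists>b'\<in>Ktuv. \<exists>c'\<in>Ktuv. \<exists>d'\<in>Ktuv.
    X = mat d' + mat a' ** x_hat + mat b' ** y_hat + mat c' ** commutator x_hat y_hat \<and>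
    ?g a b c = ?g a' b' c'"
    using assms by blast
next
  fix w
  assume "\<exists>a\<in>Ktuv. \<exists>b\<in>Ktuv. \<exists>c\<in>Ktuv. \<exists>d\<in>Ktuv.
    X = mat d + mat a ** x_hat + mat b ** y_hat + mat c ** commutator x_hat y_hat \<and> w = ?g a b c"
  then obtain a' b' c' d' where "X = mat d' + mat a' ** x_hat + mat b' ** y_hat
      + mat c' ** commutator x_hat y_hat" and w: "w = ?g a' b' c'"
    by blast
  from hat_coords_unique[OF X[symmetric, unfolded this(1), symmetric]] show "w = ?g a b c"
    unfolding w by simp
qed

lemma commutator_span:
  "commutator (mat p ** x + mat q ** y + mat r ** z) (mat d + mat a ** x + mat b ** y + mat c ** z)
    = mat (p * b - q * a) ** commutator x y + mat (p * c - r * a) ** commutator x z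
      + mat (q * c - r * b) ** commutator y z"
  by (simp add: vec_eq_iff mat_scale_nth commutator_def)
     (simp add: matrix_matrix_mult_def sum_2 forall_2 mat_scale_nth mat_nth algebra_simps)

text \<open>The matrix of \<open>ad X\<close>. Its third row comes from \<open>[x, y]\<close> itself, its third column and the terms in
  \<open>c\<close> from the double commutators \<open>[x,[x,y]] = 2 t y - 2 v x\<close> and
  \<open>[y,[x,y]] = 2 v y - 2 u x\<close>.\<close>

definition ad_matrix :: "'k::field_char_0 mser \<Rightarrow> 'k mser \<Rightarrow> 'k mser \<Rightarrow> 'k mser^3^3"
  where "ad_matrix a b c = vector [
    vector [- 2 * c * v_hat, - 2 * c * u_hat, 2 * (a * v_hat + b * u_hat)],
    vector [2 * c * t_hat, 2 * c * v_hat, - 2 * (a * t_hat + b * v_hat)],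
    vector [b, - a, 0]]"

lemma ad_lin_comb:
  assumes X: "X = mat d + mat a ** x_hat + mat b ** y_hat + mat c ** commutator x_hat y_hat"
  shows "ad X (lin_comb s) = lin_comb (ad_matrix a b c *v s)"
proof -
  let ?z = "commutator x_hat y_hat :: 'a mser^2^2"
  have xz: "commutator x_hat ?z = mat (2 * t_hat) ** y_hat - mat (2 * v_hat) ** x_hat"
    using double_commutator[OF traceless_hat] by (simp add: trace_hat)
  have yx: "commutator y_hat (commutator y_hat x_hat) = mat (2 * u_hat) ** x_hat - mat (2 * v_hat) ** y_hat"
    using double_commutator[OF traceless_hat(2,1)]
    by (simp add: trace_hat trace_mul_sym[of y_hat x_hat])
  have yz0: "commutator y_hat ?z = - commutator y_hat (commutator y_hat x_hat)"
    by (simp add: mat2_simps algebra_simps)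
  have yz: "commutator y_hat ?z = mat (2 * v_hat) ** y_hat - mat (2 * u_hat) ** x_hat"
    unfolding yz0 yx by simp
  show ?thesis
    unfolding ad_def X lin_comb_eq commutator_span xz yz
    by (simp add: vec_eq_iff mat_scale_nth matrix_vector_mult_def sum_3 ad_matrix_def algebra_simps)
qed

text \<open>The first identity is that of Cayley and Hamilton: the trace of \<open>D\<close> is \<open>0\<close>, that of \<open>D\<^sup>2\<close> is
  \<open>2 g\<close>, and \<open>det D = 0\<close> because \<open>ad X\<close> annihilates the traceless part of \<open>X\<close>.\<close>

lemma ad_matrix_cube:
  defines "g \<equiv> \<lambda>a b c. 2 * (a\<^sup>2 * t_hat + 2 * a * b * v_hat + b\<^sup>2 * u_hat
             + 2 * c\<^sup>2 * (v_hat\<^sup>2 - t_hat * u_hat))"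
  shows "ad_matrix a b c ** (ad_matrix a b c ** ad_matrix a b c) = mat (g a b c) ** ad_matrix a b c"
    and "trace (ad_matrix a b c) = 0"
    and "trace (ad_matrix a b c ** ad_matrix a b c) = 2 * g a b c"
  by (simp_all add: vec_eq_iff mat_scale_nth g_def)
    (simp_all add: forall_3 trace_def matrix_matrix_mult_def sum_3 ad_matrix_def
      algebra_simps power2_eq_square)


section \<open>Hyperbolic series and the exponential of ad X\<close>

text \<open>Substituting \<open>w\<close> into series with coefficients in the field \<open>K\<close> itself, rather than in the
  polynomial ring, leaves the coefficient identities and the inverses to the ring \<open>K[[z]]\<close>, where
  derivatives and division are available. They are then transported by the homomorphism that
  substitutes \<open>w\<close> for \<open>z\<close>.\<close>

definition subst_series :: "'k::field_char_0 mser \<Rightarrow> 'k fps \<Rightarrow> 'k mser"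
  where "subst_series w f = fps_compose (Abs_fps (\<lambda>n. Const (fps_nth f n))) w"

definition cosh_series :: "'k::field_char_0 fps"
  where "cosh_series = Abs_fps (\<lambda>n. 1 / fact (2 * n))"

definition sinh_series :: "'k::field_char_0 fps"
  where "sinh_series = Abs_fps (\<lambda>n. 1 / fact (2 * n + 1))"

definition cosh_m1_series :: "'k::field_char_0 fps"
  where "cosh_m1_series = Abs_fps (\<lambda>n. 1 / fact (2 * n + 2))"

lemma hyperbolic_eq_subst:
  "cosh_sqrt w = subst_series w cosh_series"
  "sinh_sqrt_div w = subst_series w sinh_series"
  "cosh_sqrt_m1_div w = subst_series w cosh_m1_series"
  by (simp_all add: cosh_sqrt_def sinh_sqrt_div_def cosh_sqrt_m1_div_def subst_series_def
      cosh_series_def sinh_series_def cosh_m1_series_def)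

lemma Const_add: "Const (a + b) = Const a + Const b"
  by (simp add: Const_def single_add)

lemma Const_mult: "Const (a * b) = Const a * Const b"
  by (simp add: Const_def mult_single)

lemma Const_0: "Const 0 = 0"
  by (simp add: Const_def)

lemma Const_1: "Const 1 = 1"
  by (simp add: Const_def)

lemma Const_sum: "Const (\<Sum>i\<in>I. f i) = (\<Sum>i\<in>I. Const (f i))"
  by (induction I rule: infinite_finite_induct) (auto simp: Const_add Const_0)

lemma subst_add: "subst_series w (f + h) = subst_series w f + subst_series w h"
proof -
  have "Abs_fps (\<lambda>n. Const (fps_nth (f + h) n))
      = Abs_fps (\<lambda>n. Const (fps_nth f n)) + Abs_fps (\<lambda>n. Const (fps_nth h n))"
    by (simp add: fps_eq_iff Const_add)
  then show ?thesis
    by (simp only: subst_series_def fps_compose_add_distrib)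
qed

lemma subst_mult:
  assumes "fps_nth w 0 = 0"
  shows "subst_series w (f * h) = subst_series w f * subst_series w h"
proof -
  have "Abs_fps (\<lambda>n. Const (fps_nth (f * h) n))
      = Abs_fps (\<lambda>n. Const (fps_nth f n)) * Abs_fps (\<lambda>n. Const (fps_nth h n))"
    by (simp add: fps_eq_iff fps_mult_nth Const_mult Const_sum)
  then show ?thesis
    by (simp only: subst_series_def fps_compose_mult_distrib[OF assms])
qed

lemma subst_1: "subst_series w 1 = 1"
proof -
  have "Abs_fps (\<lambda>n. Const (fps_nth 1 n)) = (1 :: 'a mser)"
    by (simp add: fps_eq_iff Const_0 Const_1)
  then show ?thesis
    by (simp add: subst_series_def)
qed

lemma subst_X:
  assumes "fps_nth w 0 = 0"
  shows "subst_series w fps_X = w"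
proof -
  have "Abs_fps (\<lambda>n. Const (fps_nth fps_X n)) = (fps_X :: 'a mser)"
    by (simp add: fps_eq_iff Const_0 Const_1 fps_X_def)
  then show ?thesis
    using assms by (simp add: subst_series_def fps_X_fps_compose_startby0)
qed

lemma subst_inverse:
  assumes "fps_nth w 0 = 0" "fps_nth f 0 \<noteq> 0"
  shows "subst_series w f * subst_series w (inverse f) = 1"
proof -
  have "f * inverse f = 1"
    using inverse_mult_eq_1[OF assms(2)] by (simp add: mult.commute)
  then show ?thesis
    using subst_mult[OF assms(1), of f "inverse f"] by (simp add: subst_1)
qed

lemma subst_Ktuv:
  assumes "w \<in> Ktuv"
  shows "subst_series w f \<in> Ktuv"
proof -
  have w: "fps_nth (w ^ i) n \<in> Ptuv" "hom_part n (fps_nth (w ^ i) n) = fps_nth (w ^ i) n" for i n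
    using Ktuv_power[OF assms, of i] by (simp_all add: Ktuv_iff)
  have "hom_part n (Const c * fps_nth (w ^ i) n) = Const c * fps_nth (w ^ i) n" for n i and c :: 'a
    using homogeneous_mult[OF homogeneous_Const w(2)] by simp
  then show ?thesis
    unfolding Ktuv_iff subst_series_def fps_compose_nth
    by (auto intro!: Ptuv_sum Ptuv_mult Ptuv_Const w homogeneous_sum)
qed

lemma cosh_eq: "cosh_series = 1 + fps_X * cosh_m1_series"
proof (rule fps_ext)
  fix n
  show "fps_nth cosh_series n = fps_nth (1 + fps_X * cosh_m1_series) n"
    by (cases n) (simp_all add: cosh_series_def cosh_m1_series_def)
qed

text \<open>With \<open>C\<close> and \<open>S\<close> the series of \<open>cosh \<surd>z\<close> and \<open>sinh \<surd>z / \<surd>z\<close>, the differential equations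
  \<open>2 C' = S\<close> and \<open>2 z S' + S = C\<close> give \<open>(C\<^sup>2 - z S\<^sup>2)' = 0\<close>. In characteristic \<open>0\<close> this
  series is therefore its constant term \<open>1\<close>.\<close>

lemma cosh_sinh_series:
  "(cosh_series :: 'k::field_char_0 fps)\<^sup>2 = 1 + fps_X * sinh_series\<^sup>2"
proof -
  let ?C = "cosh_series :: 'k fps" and ?S = "sinh_series :: 'k fps"
  have inv_fact: "(of_nat (Suc k) :: 'k) * (1 / fact (Suc k)) = 1 / fact k" for k
    using of_nat_neq_0[of k, where ?'a = 'k] by (simp add: fact_Suc del: of_nat_Suc)
  have C': "2 * fps_deriv ?C = ?S"
  proof (rule fps_ext)
    fix n
    have "(of_nat (2 * n + 2) :: 'k) * (1 / fact (2 * n + 2)) = 1 / fact (2 * n + 1)"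
      using inv_fact[of "2 * n + 1"] by (simp only: Suc_eq_plus1 add.assoc one_add_one)
    then show "fps_nth (2 * fps_deriv ?C) n = fps_nth ?S n"
      by (simp add: cosh_series_def sinh_series_def numeral_fps_const algebra_simps)
  qed
  have S': "2 * fps_X * fps_deriv ?S + ?S = ?C"
  proof (rule fps_ext)
    fix n
    have "(of_nat (2 * n + 1) :: 'k) * (1 / fact (2 * n + 1)) = 1 / fact (2 * n)"
      using inv_fact[of "2 * n"] by (simp only: Suc_eq_plus1)
    moreover have "fps_nth (fps_X * fps_deriv ?S) n = of_nat n * fps_nth ?S n"
      by (cases n) simp_all
    then have "fps_nth (2 * fps_X * fps_deriv ?S + ?S) n = of_nat (2 * n + 1) * fps_nth ?S n"
      by (simp add: numeral_fps_const mult.assoc algebra_simps)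
    ultimately show "fps_nth (2 * fps_X * fps_deriv ?S + ?S) n = fps_nth ?C n"
      by (simp add: cosh_series_def sinh_series_def)
  qed
  have "fps_deriv (?C\<^sup>2 - fps_X * ?S\<^sup>2)
      = ?C * (2 * fps_deriv ?C) - ?S * (2 * fps_X * fps_deriv ?S + ?S)"
    by (simp add: power2_eq_square algebra_simps)
  also have "\<dots> = 0"
    by (simp add: C' S')
  finally have "?C\<^sup>2 - fps_X * ?S\<^sup>2 = fps_const (fps_nth (?C\<^sup>2 - fps_X * ?S\<^sup>2) 0)"
    by (simp only: fps_deriv_eq_0_iff)
  also have "\<dots> = 1"
    by (simp add: power2_eq_square fps_mult_nth cosh_series_def)
  finally show ?thesis
    by (simp add: algebra_simps)
qed

text \<open>Both sides agree after multiplication by \<open>z\<close>, where the identity is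
  \<open>sinh\<^sup>2 = (cosh - 1) (cosh + 1)\<close>.\<close>

lemma sinh_series_square:
  "(sinh_series :: 'k::field_char_0 fps)\<^sup>2 = cosh_m1_series * (cosh_series + 1)"
proof -
  have "fps_X * sinh_series\<^sup>2 = (cosh_series :: 'k fps)\<^sup>2 - 1"
    by (simp add: cosh_sinh_series)
  also have "\<dots> = (cosh_series - 1) * (cosh_series + 1)"
    by (simp add: algebra_simps power2_eq_square)
  also have "cosh_series - 1 = fps_X * (cosh_m1_series :: 'k fps)"
    by (simp add: cosh_eq)
  finally show ?thesis
    by (simp add: mult.assoc)
qed

text \<open>Each coefficient of a substituted series is a finite sum, as \<open>w\<^sup>n\<close> has no terms below degree
  \<open>n\<close>. This is what turns convergence of the exponential series into equality of
  coefficients from some point on.\<close>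

lemma subst_series_nth:
  assumes w0: "fps_nth w 0 = 0" and m: "m < M"
  shows "fps_nth (subst_series w f) m = fps_nth (\<Sum>n<M. konst (fps_nth f n) * w ^ n) m"
proof -
  have "fps_nth (subst_series w f) m = (\<Sum>n=0..m. Const (fps_nth f n) * fps_nth (w ^ n) m)"
    by (simp add: subst_series_def fps_compose_nth)
  also have "\<dots> = (\<Sum>n<M. Const (fps_nth f n) * fps_nth (w ^ n) m)"
    using m by (intro sum.mono_neutral_left) (auto simp: startsby_zero_power_prefix[OF w0])
  finally show ?thesis
    by (simp add: fps_sum_nth konst_def)
qed

lemma ad_scale: "ad X (mat f ** z) = mat f ** ad X z"
  unfolding ad_def commutator_def mat_scale_right matrix_mul_assoc[symmetric]
  by (simp add: vec_eq_iff mat_scale_nth algebra_simps)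

lemma ad_funpow:
  assumes cube: "ad X (ad X (ad X z)) = mat g ** ad X z"
  shows "(ad X ^^ (2 * n + 1)) z = mat (g ^ n) ** ad X z"
    and "(ad X ^^ (2 * n + 2)) z = mat (g ^ n) ** ad X (ad X z)"
proof -
  show *: "(ad X ^^ (2 * n + 1)) z = mat (g ^ n) ** ad X z"
  proof (induction n)
    case (Suc n)
    have "(ad X ^^ (2 * Suc n + 1)) z = ad X (ad X ((ad X ^^ (2 * n + 1)) z))"
      by simp
    also have "\<dots> = mat (g ^ Suc n) ** ad X z"
      unfolding Suc.IH ad_scale cube by (simp add: matrix_mul_assoc mat_mult_mat mult.commute)
    finally show ?case .
  qed simp
  have "(ad X ^^ (2 * n + 2)) z = ad X ((ad X ^^ (2 * n + 1)) z)"
    by simp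
  then show "(ad X ^^ (2 * n + 2)) z = mat (g ^ n) ** ad X (ad X z)"
    unfolding * ad_scale .
qed

text \<open>Up to the \<open>N\<close>-th power there are \<open>(N + 1) div 2\<close> odd exponents and \<open>N div 2\<close> positive even
  ones.\<close>

lemma exp_ad_partial_sum:
  assumes cube: "ad X (ad X (ad X z)) = mat g ** ad X z"
  shows "(\<Sum>k<Suc N. mat (konst (1 / fact k)) ** (ad X ^^ k) z)
    = z + mat (\<Sum>n<Suc N div 2. konst (fps_nth sinh_series n) * g ^ n) ** ad X z
        + mat (\<Sum>n<N div 2. konst (fps_nth cosh_m1_series n) * g ^ n) ** ad X (ad X z)"
proof (induction N)
  case 0
  then show ?case
    by (simp add: konst_def Const_1)
next
  case (Suc N)
  show ?case
  proof (cases "even N")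
    case True
    then obtain n where n: "N = 2 * n" by blast
    have "mat (konst (1 / fact (Suc N))) ** (ad X ^^ Suc N) z
        = mat (konst (fps_nth sinh_series n) * g ^ n) ** ad X z"
      using ad_funpow(1)[OF cube, of n]
      by (simp add: n sinh_series_def matrix_mul_assoc mat_mult_mat del: funpow.simps)
    then show ?thesis
      unfolding sum.lessThan_Suc[of _ "Suc N"] Suc.IH
      by (simp add: n vec_eq_iff mat_scale_nth ring_distribs del: funpow.simps)
  next
    case False
    then obtain n where n: "N = 2 * n + 1" by (elim oddE)
    have "mat (konst (1 / fact (Suc N))) ** (ad X ^^ Suc N) z
        = mat (konst (fps_nth cosh_m1_series n) * g ^ n) ** ad X (ad X z)"
      using ad_funpow(2)[OF cube, of n]
      by (simp add: n cosh_m1_series_def matrix_mul_assoc mat_mult_mat del: funpow.simps)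
    then show ?thesis
      unfolding sum.lessThan_Suc[of _ "Suc N"] Suc.IH
      by (simp add: n vec_eq_iff mat_scale_nth ring_distribs del: funpow.simps)
  qed
qed

lemma fps_nth_mult_cong:
  assumes "\<And>i. i \<le> m \<Longrightarrow> fps_nth f i = fps_nth f' i"
  shows "fps_nth (f * h) m = fps_nth (f' * h) m"
  using assms by (simp add: fps_mult_nth)

text \<open>Where \<open>ad X\<close> satisfies \<open>\<delta>\<^sup>3 = g \<delta>\<close>, its odd powers are \<open>g\<^sup>n \<delta>\<close> and its positive even ones
  \<open>g\<^sup>n \<delta>\<^sup>2\<close>. As \<open>g\<close> has no constant term, every coefficient of the partial sums is eventually
  constant, which is convergence in the formal power series topology.\<close>

lemma exp_ad_eq:
  assumes cube: "ad X (ad X (ad X z)) = mat g ** ad X z" and g0: "fps_nth g 0 = 0"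
  shows "exp_ad X z = z + mat (sinh_sqrt_div g) ** ad X z + mat (cosh_sqrt_m1_div g) ** ad X (ad X z)"
    (is "_ = ?L")
proof -
  let ?S = "\<lambda>N. \<Sum>k<N. mat (konst (1 / fact k)) ** (ad X ^^ k) z"
  \<comment> \<open>The degrees \<open>k \<le> m\<close> are settled once both inner sums have more than \<open>m\<close> terms.\<close>
  have stable: "fps_nth (?S (Suc N) $ i $ j) m = fps_nth (?L $ i $ j) m" if "2 * m + 2 \<le> N" for N m i j
  proof -
    have "m < Suc N div 2" "m < N div 2"
      using that by auto
    then have *: "fps_nth (\<Sum>n<Suc N div 2. konst (fps_nth sinh_series n) * g ^ n) k
          = fps_nth (subst_series g sinh_series) k"
      "fps_nth (\<Sum>n<N div 2. konst (fps_nth cosh_m1_series n) * g ^ n) k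
          = fps_nth (subst_series g cosh_m1_series) k" if "k \<le> m" for k
      using that by (simp_all only: subst_series_nth[OF g0, symmetric] le_less_trans)
    show ?thesis
      unfolding exp_ad_partial_sum[OF cube] hyperbolic_eq_subst
      using fps_nth_mult_cong[OF *(1)] fps_nth_mult_cong[OF *(2)]
      by (simp add: mat_scale_nth)
  qed
  have "fps_nth (?S N $ i $ j) m = fps_nth (?L $ i $ j) m" if "2 * m + 3 \<le> N" for N m i j
    using stable[of m "N - 1" i j] that by (simp add: Suc_diff_le del: sum.lessThan_Suc)
  then have "eventually (\<lambda>N. fps_nth (?S N $ i $ j) m = fps_nth (?L $ i $ j) m) sequentially" for i j m
    by (rule eventually_sequentiallyI)
  then have "?S \<longlonglongrightarrow> ?L"
    by (intro vec_tendstoI tendsto_fpsI)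
  then show ?thesis
    unfolding exp_ad_def by (intro sums_unique[symmetric]) (simp add: sums_def)
qed


section \<open>The logarithm formula\<close>

text \<open>Any matrix with \<open>D\<^sup>3 = g D\<close> spans with \<open>1\<close> and \<open>D\<^sup>2\<close> a commutative algebra that contains \<open>Q\<close>
  and \<open>Q\<^sup>2 = 1 + 2 A C D + 2 A\<^sup>2 D\<^sup>2\<close>. The formula eliminates \<open>D\<^sup>2\<close> between \<open>Q\<close> and \<open>Q\<^sup>2\<close>.
  Here \<open>B'\<close> and \<open>h\<close> are the inverses of \<open>B\<close> and \<open>2 A\<close>.\<close>

lemma matrix_log_formula:
  fixes D Q :: "'r::comm_ring_1^'n^'n"
  assumes cube: "D ** (D ** D) = mat g ** D"
    and Q: "Q = mat 1 + mat A ** D + mat B ** (D ** D)"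
    and C: "C = 1 + g * B" and A2: "A\<^sup>2 = B * (C + 1)"
    and B': "B * B' = 1" and h: "2 * A * h = 1"
  shows "D = mat (A * B') ** (Q - mat 1) - mat h ** (Q ** Q - mat 1)"
proof -
  let ?P = "D ** D"
  have PD: "?P ** D = mat g ** D" and PP: "?P ** ?P = mat g ** ?P"
    using cube by (simp_all add: matrix_mul_assoc)
  have Q1: "Q - mat 1 = mat A ** D + mat B ** ?P"
    by (simp add: Q)
  have "Q ** Q = Q + mat A ** (D ** Q) + mat B ** (?P ** Q)"
    by (subst (1) Q) (simp add: matrix_add_rdistrib matrix_mul_assoc)
  also have "D ** Q = D + mat A ** ?P + mat B ** (mat g ** D)"
    unfolding Q by (simp add: matrix_add_ldistrib mat_scale_right[of D] cube)
  also have "?P ** Q = ?P + mat A ** (mat g ** D) + mat B ** (mat g ** ?P)"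
    unfolding Q by (simp add: matrix_add_ldistrib mat_scale_right[of ?P] PD PP)
  finally have Q2: "Q ** Q = Q + mat A ** (D + mat A ** ?P + mat B ** (mat g ** D))
      + mat B ** (?P + mat A ** (mat g ** D) + mat B ** (mat g ** ?P))" .
  have QQ: "(Q ** Q - mat 1) $ i $ j = (2 * A * C) * D $ i $ j + (2 * A\<^sup>2) * ?P $ i $ j" for i j
  proof -
    \<comment> \<open>Without the factor \<open>p\<close>: \<open>2 B + g B\<^sup>2 = B (2 + g B) = B (C + 1)\<close>.\<close>
    have "2 * B * p + g * (B\<^sup>2 * p) = A\<^sup>2 * p" for p
      unfolding A2 C by (simp add: power2_eq_square algebra_simps)
    from this[of "?P $ i $ j"] show ?thesis
      unfolding Q2 unfolding Q by (simp add: mat_scale_nth C power2_eq_square algebra_simps)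
  qed
  have "D $ i $ j = (A * B') * (Q - mat 1) $ i $ j - h * (Q ** Q - mat 1) $ i $ j" for i j
  proof -
    have "(A * B') * (Q - mat 1) $ i $ j = (B * B') * (C + 1) * D $ i $ j + (B * B') * A * ?P $ i $ j"
    proof -
      have "(A * B') * (Q - mat 1) $ i $ j = (A\<^sup>2 * B') * D $ i $ j + (B * B') * A * ?P $ i $ j"
        unfolding Q1 by (simp add: mat_scale_nth power2_eq_square algebra_simps)
      also have "A\<^sup>2 * B' = (B * B') * (C + 1)"
        by (simp only: A2 mult_ac)
      finally show ?thesis .
    qed
    moreover have "h * (Q ** Q - mat 1) $ i $ j = (2 * A * h) * C * D $ i $ j + (2 * A * h) * A * ?P $ i $ j"
      unfolding QQ by (simp add: power2_eq_square algebra_simps)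
    ultimately show ?thesis
      unfolding B' h by (simp add: algebra_simps)
  qed
  then show ?thesis
    by (simp add: vec_eq_iff mat_scale_nth)
qed

lemma matrix_vector_mult_axis: "M *v axis j 1 = column j (M :: 'r::comm_ring_1^'n^'m)"
  by (simp add: vec_eq_iff column_def matrix_vector_mult_def axis_def if_distrib cong: if_cong)

lemma konst_half: "2 * konst (1 / 2) = (1 :: 'k::field_char_0 mser)"
proof -
  have "konst (1 / 2) + konst (1 / 2 :: 'k) = fps_const (Const (1 / 2 + 1 / 2))"
    by (simp only: konst_def Const_add fps_const_add)
  also have "1 / 2 + 1 / 2 = (1 :: 'k)"
    by simp
  finally show ?thesis
    by (simp only: mult_2 Const_1 fps_const_1_eq_1)
qed

lemma unit_inv_eq: "f * h = 1 \<Longrightarrow> unit_inv f = h"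
  unfolding unit_inv_def by (rule the_equality) (metis mult.assoc mult.commute mult_1)+

theorem theorem6:
  fixes X :: "'k::field_char_0 mser^2^2"
    and Q :: "'k mser^3^3"
  assumes "X \<in> W_hat"
    and "Q = assoc_mat (exp_ad X)"
  shows "cosh_sqrt (g_ser X) = konst (1 / 2) * (trace Q - 1)
    \<and> assoc_mat (ad X) =
        mat (A_ser X * unit_inv (B_ser X)) ** (Q - mat 1)
        - mat (unit_inv (2 * A_ser X)) ** (Q ** Q - mat 1)"
proof -
  obtain a b c d where abcd: "a \<in> Ktuv" "b \<in> Ktuv" "c \<in> Ktuv" "d \<in> Ktuv"
    and X: "X = mat d + mat a ** x_hat + mat b ** y_hat + mat c ** commutator x_hat y_hat"
    using W_hat_span[OF assms(1)] by blast
  define g where "g = g_ser X"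
  define D where "D = ad_matrix a b c"
  define A B C where "A = subst_series g sinh_series" and "B = subst_series g cosh_m1_series"
    and "C = subst_series g cosh_series"
  define A' B' where "A' = subst_series g (inverse sinh_series)"
    and "B' = subst_series g (inverse cosh_m1_series)"
  note g_eq = g_ser_eq[OF abcd X, folded g_def]
  have g: "g \<in> Ktuv"
    unfolding g_eq by (intro Ktuv_closed abcd)
  have g0: "fps_nth g 0 = 0"
    unfolding g_eq by (simp add: tuv_hat_eq fps_mult_nth power2_eq_square)
  note D_facts = ad_matrix_cube[of a b c, folded g_eq, folded D_def]
  have D_Ktuv: "D $ i $ j \<in> Ktuv" for i j
    using exhaust_3[of i] exhaust_3[of j] abcd
    by (auto simp: D_def ad_matrix_def intro!: Ktuv_closed)
  have A: "A \<in> Ktuv" and B: "B \<in> Ktuv"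
    by (simp_all add: A_def B_def subst_Ktuv g)
  have ad_comb: "ad X (lin_comb s) = lin_comb (D *v s)" for s
    unfolding D_def by (rule ad_lin_comb[OF X])
  have basis: "basis3 $ j = lin_comb (axis j 1)" for j
    using exhaust_3[of j] by (auto simp: lin_comb_eq basis3_def axis_def)
  have ad_basis: "ad X (basis3 $ j) = lin_comb (column j D)" for j
    unfolding basis ad_comb matrix_vector_mult_axis ..
  have ad2_basis: "ad X (ad X (basis3 $ j)) = lin_comb (column j (D ** D))" for j
    unfolding basis ad_comb matrix_vector_mul_assoc unfolding matrix_vector_mult_axis ..
  have ad3_basis: "ad X (ad X (ad X (basis3 $ j))) = mat g ** ad X (basis3 $ j)" for j
    unfolding basis ad_comb matrix_vector_mul_assoc
    unfolding matrix_vector_mult_axis matrix_mul_assoc[symmetric] D_facts(1)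
    by (simp add: lin_comb_eq vec_eq_iff mat_scale_nth column_def algebra_simps)
  have M_ad: "assoc_mat (ad X) = D"
    by (intro assoc_mat_eqI D_Ktuv ad_basis)
  have cosh: "C = 1 + g * B"
    unfolding C_def B_def cosh_eq subst_add subst_1 subst_mult[OF g0] subst_X[OF g0] ..
  have A2: "A\<^sup>2 = B * (C + 1)"
  proof -
    have "A\<^sup>2 = subst_series g (sinh_series\<^sup>2)"
      by (simp only: A_def power2_eq_square subst_mult[OF g0])
    then show ?thesis
      by (simp only: sinh_series_square B_def C_def subst_add subst_1 subst_mult[OF g0])
  qed
  have Q: "Q = mat 1 + mat A ** D + mat B ** (D ** D)" (is "_ = ?M")
    unfolding assms(2)
  proof (rule assoc_mat_eqI)
    show "?M $ i $ j \<in> Ktuv" for i j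
      unfolding vector_add_component mat_scale_nth mat_nth matrix_matrix_mult_def
      by (auto intro!: Ktuv_closed Ktuv_sum A B D_Ktuv)
    show "exp_ad X (basis3 $ j) = lin_comb (column j ?M)" for j
      unfolding exp_ad_eq[OF ad3_basis g0] ad2_basis unfolding ad_basis hyperbolic_eq_subst
      unfolding basis A_def[symmetric] B_def[symmetric]
      by (simp add: lin_comb_eq vec_eq_iff mat_scale_nth mat_nth column_def axis_def algebra_simps)
  qed
  have "trace Q = 1 + 2 * C"
  proof -
    have "trace (mat f ** M) = f * trace M" for f and M :: "'k mser^3^3"
      by (simp add: trace_def mat_scale_nth sum_distrib_left)
    then show ?thesis
      unfolding Q cosh by (simp add: trace_add D_facts trace_I algebra_simps)
  qed
  then have "konst (1 / 2) * (trace Q - 1) = (konst (1 / 2) * 2) * C"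
    by simp
  also have "konst (1 / 2) * 2 = (1 :: 'k mser)"
    by (simp only: konst_half mult.commute[of _ 2])
  finally have trace_Q: "C = konst (1 / 2) * (trace Q - 1)"
    by simp
  have AA': "A * A' = 1" and BB': "B * B' = 1"
    unfolding A_def A'_def B_def B'_def
    by (simp_all add: subst_inverse g0 sinh_series_def cosh_m1_series_def)
  define h where "h = konst (1 / 2) * A'"
  have h: "2 * A * h = 1"
  proof -
    have "2 * A * h = (2 * konst (1 / 2)) * (A * A')"
      by (simp only: h_def mult_ac)
    then show ?thesis
      by (simp only: konst_half AA' mult_1)
  qed
  have "unit_inv B = B'" "unit_inv (2 * A) = h"
    using BB' h by (simp_all add: unit_inv_eq)
  then show ?thesis
    using trace_Q matrix_log_formula[OF D_facts(1) Q cosh A2 BB' h] M_ad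
    by (simp add: A_ser_def B_ser_def hyperbolic_eq_subst A_def B_def C_def g_def)
qed

end
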